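(* Let $X$ be a completely regular Hausdorff space and let $A\subseteq X$ be a closed set. The following assertions are equivalent: (a) $A=\overline{\operatorname{Int} A}$, where interior and closure are taken in $X$. (b) For every net $(f_\alpha)$ in $C(X)$ and every $f\in C(X)$, if $f_\alpha\nearrow f$ in $C(X)$, then $f_\alpha|_A\nearrow f|_A$ in $C(A)$. (c) For every net $(f_\alpha)$ in $C_b(X)$ and every $f\in C_b(X)$, if $f_\alpha\nearrow f$ in $C_b(X)$, then $f_\alpha|_A\nearrow f|_A$ in $C_b(A)$.
   Context: For a topological space $Y$, $C(Y)$ denotes the vector lattice of all continuous real-valued functions on $Y$ with the pointwise order, and $C_b(Y)$ the vector lattice of all bounded ones. The subset $A$ carries the subspace topology. For a net $(x_\alpha)$ and an element $x$ in a vector lattice $E$, $x_\alpha\nearrow x$ in $E$ means that the net is increasing and that $x$ is its supremum in $E$ (the supremum taken in the vector lattice $E$, not pointwise). *)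

theory Defs
  imports "HOL-Analysis.Analysis" "HOL-Algebra.Order"
begin

text \<open>
  Only the order of the vector lattices \<open>C(Y)\<close> and \<open>C\<^sub>b(Y)\<close> enters into \<open>\<nearrow>\<close>, so they are
  given as ordered sets. A function on \<open>topspace Y\<close> is represented by its extensional
  representative; hence HOL equality is equality of functions on \<open>topspace Y\<close>, the pointwise
  order is antisymmetric, and \<open>f|\<^sub>A\<close> is \<open>restrict f A\<close>.
\<close>

definition pointwise_order :: "'a set \<Rightarrow> ('a \<Rightarrow> real) set \<Rightarrow> ('a \<Rightarrow> real) gorder" where
  "pointwise_order S F = \<lparr>carrier = F, eq = (=), le = (\<lambda>f g. \<forall>x\<in>S. f x \<le> g x)\<rparr>"

definition C_space :: "'a topology \<Rightarrow> ('a \<Rightarrow> real) gorder" where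
  "C_space Y = pointwise_order (topspace Y)
     {f \<in> extensional (topspace Y). continuous_map Y euclideanreal f}"

definition Cb_space :: "'a topology \<Rightarrow> ('a \<Rightarrow> real) gorder" where
  "Cb_space Y = pointwise_order (topspace Y)
     {f \<in> extensional (topspace Y). continuous_map Y euclideanreal f \<and> bounded (f ` topspace Y)}"

lemma partial_order_pointwise:
  assumes "F \<subseteq> extensional S"
  shows "partial_order (pointwise_order S F)"
proof
  fix f g
  assume "f \<sqsubseteq>\<^bsub>pointwise_order S F\<^esub> g" "g \<sqsubseteq>\<^bsub>pointwise_order S F\<^esub> f"
    "f \<in> carrier (pointwise_order S F)" "g \<in> carrier (pointwise_order S F)"
  then show "f .=\<^bsub>pointwise_order S F\<^esub> g"
    using assms by (auto simp: pointwise_order_def intro: extensionalityI[of f S g] order.antisym)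
qed (auto simp: pointwise_order_def intro: order_trans)

lemma partial_order_C_space: "partial_order (C_space Y)"
  unfolding C_space_def by (rule partial_order_pointwise) auto

lemma partial_order_Cb_space: "partial_order (Cb_space Y)"
  unfolding Cb_space_def by (rule partial_order_pointwise) auto

definition directed_set :: "'j set \<Rightarrow> ('j \<times> 'j) set \<Rightarrow> bool" where
  "directed_set I r \<longleftrightarrow>
     I \<noteq> {} \<and> preorder_on I r \<and> (\<forall>i\<in>I. \<forall>j\<in>I. \<exists>k\<in>I. (i, k) \<in> r \<and> (j, k) \<in> r)"

text \<open>
  \<open>x\<^sub>i \<nearrow> l\<close> in \<open>E\<close>. \<open>Upper E\<close> consists of the upper bounds lying in \<open>E\<close>, so that
  \<open>l\<close> is an element of \<open>E\<close> and the supremum is the one taken in \<open>E\<close>.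
\<close>

definition increases_to ::
  "'e gorder \<Rightarrow> 'j set \<Rightarrow> ('j \<times> 'j) set \<Rightarrow> ('j \<Rightarrow> 'e) \<Rightarrow> 'e \<Rightarrow> bool" where
  "increases_to E I r x l \<longleftrightarrow>
     directed_set I r \<and> (\<forall>i\<in>I. x i \<in> carrier E) \<and>
     (\<forall>(i, j)\<in>r. x i \<sqsubseteq>\<^bsub>E\<^esub> x j) \<and> least E l (Upper E (x ` I))"

text \<open>
  HOL cannot quantify over all index types inside a formula. In statements of the form
  ``for every net of functions \<open>'a \<Rightarrow> real\<close>'' the index sets are therefore the subsets of the
  type below. Since \<open>'i\<close> is an arbitrary type, nets over every index type are covered
  (via \<open>Inr\<close>). The summand \<open>'a \<Rightarrow> real\<close> makes the type large enough, whatever \<open>'i\<close> is, for an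
  upward directed set of functions to be a net indexed by itself; with, say, a finite index type
  a statement about all nets would be void.
\<close>

type_synonym ('a, 'i) net_index = "('a \<Rightarrow> real) + 'i"

end

theory Submission
  imports Defs
begin

text \<open>
  If \<open>A\<close> is the closure of its interior and \<open>g < f\<close> somewhere on \<open>A\<close> for an upper bound \<open>g\<close> of
  the restricted net, then \<open>f - g > \<epsilon>\<close> on a nonempty open \<open>V \<subseteq> A\<close>, and lowering \<open>f\<close> by \<open>\<epsilon>\<close> times
  a bump function supported in \<open>V\<close> gives a smaller upper bound on all of \<open>X\<close>.
  Conversely, if \<open>a \<in> A\<close> has an open neighbourhood \<open>W\<close> disjoint from the interior of \<open>A\<close>, take a
  bump \<open>h\<close> at \<open>a\<close> supported in \<open>W\<close>. Since \<open>W - A\<close> is dense in \<open>W\<close>, the functions between \<open>0\<close> and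
  \<open>h\<close> that vanish on \<open>A\<close> increase to \<open>h\<close>, whereas their restrictions to \<open>A\<close> are all \<open>0\<close>.
\<close>

section \<open>Spaces of continuous functions as ordered sets\<close>

text \<open>The flag \<open>b\<close> selects the bounded functions, so that \<open>C\<close> and \<open>C\<^sub>b\<close> are treated at once.\<close>

definition cfuns :: "bool \<Rightarrow> 'a topology \<Rightarrow> ('a \<Rightarrow> real) set" where
  "cfuns b Y = {f \<in> extensional (topspace Y).
     continuous_map Y euclideanreal f \<and> (b \<longrightarrow> bounded (f ` topspace Y))}"

lemma C_space_eq: "C_space Y = pointwise_order (topspace Y) (cfuns False Y)"
  by (simp add: C_space_def cfuns_def)

lemma Cb_space_eq: "Cb_space Y = pointwise_order (topspace Y) (cfuns True Y)"
  by (simp add: Cb_space_def cfuns_def)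

lemma carrier_pointwise_order [simp]: "carrier (pointwise_order S F) = F"
  by (simp add: pointwise_order_def)

lemma le_pointwise_order [simp]: "f \<sqsubseteq>\<^bsub>pointwise_order S F\<^esub> g \<longleftrightarrow> (\<forall>x\<in>S. f x \<le> g x)"
  by (simp add: pointwise_order_def)

text \<open>Reduces suprema to pointwise inequalities. The competitors \<open>u\<close> range over
  \<open>F\<close> only, so the supremum depends on the function space.\<close>

lemma increases_to_pointwise_order:
  "increases_to (pointwise_order S F) I r \<phi> l \<longleftrightarrow>
     directed_set I r \<and> (\<forall>i\<in>I. \<phi> i \<in> F) \<and> (\<forall>(i, j)\<in>r. \<forall>x\<in>S. \<phi> i x \<le> \<phi> j x) \<and>
     l \<in> F \<and> (\<forall>i\<in>I. \<forall>x\<in>S. \<phi> i x \<le> l x) \<and>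
     (\<forall>u\<in>F. (\<forall>i\<in>I. \<forall>x\<in>S. \<phi> i x \<le> u x) \<longrightarrow> (\<forall>x\<in>S. l x \<le> u x))"
  unfolding increases_to_def least_def Upper_def by auto

lemma bounded_image_real_iff:
  fixes f :: "'a \<Rightarrow> real"
  shows "bounded (f ` S) \<longleftrightarrow> (\<exists>B. \<forall>x\<in>S. \<bar>f x\<bar> \<le> B)"
  by (auto simp: bounded_iff)

lemma continuous_map_restrict_topspace:
  assumes "continuous_map X Y f"
  shows "continuous_map X Y (restrict f (topspace X))"
  by (rule continuous_map_eq[OF assms]) simp

lemma restrict_in_cfuns:
  assumes "continuous_map Y euclideanreal f" "b \<Longrightarrow> bounded (f ` topspace Y)"
  shows "restrict f (topspace Y) \<in> cfuns b Y"
  using assms by (simp add: cfuns_def continuous_map_restrict_topspace)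

lemma cfuns_restrict:
  assumes "f \<in> cfuns b X" "A \<subseteq> topspace X"
  shows "restrict f A \<in> cfuns b (subtopology X A)"
proof -
  have "continuous_map (subtopology X A) euclideanreal f"
    using assms by (simp add: cfuns_def continuous_map_from_subtopology)
  moreover have "bounded (f ` A)" if b
    using that assms by (auto simp: cfuns_def intro: bounded_subset)
  ultimately show ?thesis
    using restrict_in_cfuns[of "subtopology X A" f b] assms(2) by (simp add: inf_absorb2)
qed

text \<open>Complete regularity separates \<open>x\<close> from the closed complement of
  \<open>V\<close> by some \<open>f\<close> that is \<open>0\<close> at \<open>x\<close> and
  \<open>1\<close> off \<open>V\<close>; the bump is \<open>1 - f\<close>.\<close>

lemma completely_regular_bump:
  assumes "completely_regular_space X" "openin X V" "x \<in> V"
  obtains h :: "'a \<Rightarrow> real" where "continuous_map X euclideanreal h"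
    "\<And>y. y \<in> topspace X \<Longrightarrow> 0 \<le> h y \<and> h y \<le> 1" "h x = 1"
    "\<And>y. y \<in> topspace X \<Longrightarrow> y \<notin> V \<Longrightarrow> h y = 0"
proof -
  have "closedin X (topspace X - V)" "x \<in> topspace X - (topspace X - V)"
    using assms(2,3) openin_subset by auto
  then obtain f :: "'a \<Rightarrow> real" where f: "continuous_map X (top_of_set {0..1}) f" "f x = 0"
      "f ` (topspace X - V) \<subseteq> {1}"
    using assms(1) unfolding completely_regular_space_def by meson
  have fc: "continuous_map X euclideanreal f" and fb: "\<And>y. y \<in> topspace X \<Longrightarrow> f y \<in> {0..1}"
    using f(1) by (auto simp: continuous_map_in_subtopology)
  show thesis
    by (rule that[of "\<lambda>y. 1 - f y"]) (use f fb in \<open>auto intro!: continuous_intros fc\<close>)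
qed

section \<open>Restriction to a regular closed set preserves suprema\<close>

lemma increases_to_restrict:
  fixes X :: "'a topology"
  assumes cr: "completely_regular_space X" and A: "A = X closure_of (X interior_of A)"
    and inc: "increases_to (pointwise_order (topspace X) (cfuns b X)) I r \<phi> f"
  shows "increases_to (pointwise_order A (cfuns b (subtopology X A))) I r
           (\<lambda>i. restrict (\<phi> i) A) (restrict f A)"
proof -
  have sub: "A \<subseteq> topspace X"
    using A by (metis closure_of_subset_topspace)
  have dir: "directed_set I r" and \<phi>: "\<And>i. i \<in> I \<Longrightarrow> \<phi> i \<in> cfuns b X"
    and mono: "\<And>i j x. (i, j) \<in> r \<Longrightarrow> x \<in> topspace X \<Longrightarrow> \<phi> i x \<le> \<phi> j x"
    and f: "f \<in> cfuns b X" and ub: "\<And>i x. i \<in> I \<Longrightarrow> x \<in> topspace X \<Longrightarrow> \<phi> i x \<le> f x"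
    and least: "\<And>u x. u \<in> cfuns b X \<Longrightarrow> (\<And>i x. i \<in> I \<Longrightarrow> x \<in> topspace X \<Longrightarrow> \<phi> i x \<le> u x)
      \<Longrightarrow> x \<in> topspace X \<Longrightarrow> f x \<le> u x"
    using inc unfolding increases_to_pointwise_order by blast+
  have "f a \<le> g a"
    if g: "g \<in> cfuns b (subtopology X A)" and gub: "\<And>i x. i \<in> I \<Longrightarrow> x \<in> A \<Longrightarrow> \<phi> i x \<le> g x"
      and a: "a \<in> A" for g a
  proof (rule ccontr)
    assume neg: "\<not> f a \<le> g a"
    \<comment> \<open>Half the gap at \<open>a\<close>: positive, yet small enough that
      \<open>a\<close> lies in the set where \<open>f - g > \<epsilon>\<close>.\<close>
    define \<epsilon> where "\<epsilon> = (f a - g a) / 2"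
    have \<epsilon>: "\<epsilon> > 0" "\<epsilon> < f a - g a"
      using neg by (auto simp: \<epsilon>_def field_simps)
    have fX: "continuous_map X euclideanreal f"
      using f by (simp add: cfuns_def)
    have "continuous_map (subtopology X A) euclideanreal (\<lambda>y. f y - g y)"
      using g by (intro continuous_map_diff continuous_map_from_subtopology[OF fX])
        (simp add: cfuns_def)
    then have "openin (subtopology X A) {y \<in> topspace (subtopology X A). f y - g y \<in> {\<epsilon><..}}"
      by (rule openin_continuous_map_preimage) simp
    then obtain U where U: "openin X U" "{y \<in> A. f y - g y > \<epsilon>} = U \<inter> A"
      using sub by (auto simp: openin_subtopology inf_absorb2)
    have "a \<in> U"
      using U(2) a \<epsilon> by blast
    \<comment> \<open>The set where \<open>f - g > \<epsilon>\<close> is open only relative to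
      \<open>A\<close>, and \<open>a\<close> may be a boundary point. Since \<open>a\<close> is in
      the closure of the interior, \<open>U\<close> contains an interior point \<open>x\<close>, and
      the bump is centred there.\<close>
    then obtain x where x: "x \<in> X interior_of A" "x \<in> U"
      using a A U(1) by (metis in_closure_of)
    obtain h :: "'a \<Rightarrow> real" where h: "continuous_map X euclideanreal h"
      "\<And>y. y \<in> topspace X \<Longrightarrow> 0 \<le> h y \<and> h y \<le> 1" "h x = 1"
      "\<And>y. y \<in> topspace X \<Longrightarrow> y \<notin> U \<inter> X interior_of A \<Longrightarrow> h y = 0"
      using completely_regular_bump[OF cr openin_Int[OF U(1) openin_interior_of] IntI[OF x(2,1)]]
      by metis
    define k where "k = restrict (\<lambda>y. f y - \<epsilon> * h y) (topspace X)"
    have "k \<in> cfuns b X"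
      unfolding k_def
    proof (rule restrict_in_cfuns)
      show "continuous_map X euclideanreal (\<lambda>y. f y - \<epsilon> * h y)"
        by (intro continuous_intros fX h)
      assume b
      then obtain B where B: "\<And>y. y \<in> topspace X \<Longrightarrow> \<bar>f y\<bar> \<le> B"
        using f by (auto simp: cfuns_def bounded_image_real_iff)
      have "\<bar>f y - \<epsilon> * h y\<bar> \<le> B + \<epsilon>" if "y \<in> topspace X" for y
      proof -
        have "0 \<le> \<epsilon> * h y" "\<epsilon> * h y \<le> \<epsilon>"
          using h(2)[OF that] \<epsilon>(1) by (auto simp: mult_left_le)
        then show ?thesis
          using B[OF that] by linarith
      qed
      then show "bounded ((\<lambda>y. f y - \<epsilon> * h y) ` topspace X)"
        unfolding bounded_image_real_iff by blast
    qed
    \<comment> \<open>On \<open>U \<inter> X interior_of A\<close>,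
      \<open>k \<ge> f - \<epsilon> > g\<close>, and \<open>g\<close> bounds the net there;
      elsewhere \<open>h\<close> vanishes and \<open>k = f\<close>.\<close>
    moreover have "\<phi> i y \<le> k y" if i: "i \<in> I" and y: "y \<in> topspace X" for i y
    proof (cases "y \<in> U \<inter> X interior_of A")
      case True
      then have yA: "y \<in> A" "y \<in> U"
        using interior_of_subset by fastforce+
      then have "f y - g y > \<epsilon>"
        using U(2) by blast
      moreover have "\<epsilon> * h y \<le> \<epsilon>"
        using h(2)[OF y] \<epsilon>(1) by (simp add: mult_left_le)
      ultimately show ?thesis
        using gub[OF i yA(1)] y by (simp add: k_def)
    next
      case False
      then show ?thesis
        using h(4)[OF y] ub[OF i y] y by (simp add: k_def)
    qed
    moreover have xX: "x \<in> topspace X"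
      using U(1) x(2) openin_subset by auto
    ultimately have "f x \<le> k x"
      by (rule least)
    then show False
      using h(3) \<epsilon>(1) xX by (simp add: k_def)
  qed
  then show ?thesis
    unfolding increases_to_pointwise_order
    using dir \<phi> mono f ub subsetD[OF sub] by (auto intro: cfuns_restrict[OF _ sub])
qed

section \<open>A net whose supremum is lost under restriction\<close>

text \<open>Turns an upward directed set of functions into a net indexed by itself;
  \<open>Inl\<close> places the indices in \<open>net_index\<close>.\<close>

lemma directed_net_of_functions:
  assumes "F \<noteq> {}"
    and "\<And>f g. f \<in> F \<Longrightarrow> g \<in> F \<Longrightarrow> \<exists>k\<in>F. \<forall>x\<in>S. f x \<le> k x \<and> g x \<le> (k x :: real)"
  shows "directed_set (Inl ` F) {(Inl f, Inl g) | f g. f \<in> F \<and> g \<in> F \<and> (\<forall>x\<in>S. f x \<le> g x)}"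
    (is "directed_set _ ?r")
  unfolding directed_set_def preorder_on_def
proof (intro conjI)
  show "refl_on (Inl ` F) ?r"
    by (auto simp: refl_on_def)
  show "trans ?r"
  proof (rule transI)
    fix i j k assume "(i, j) \<in> ?r" "(j, k) \<in> ?r"
    then obtain f g h where "i = Inl f" "j = Inl g" "k = Inl h" "f \<in> F" "h \<in> F"
      "\<And>x. x \<in> S \<Longrightarrow> f x \<le> g x" "\<And>x. x \<in> S \<Longrightarrow> g x \<le> h x"
      by blast
    then show "(i, k) \<in> ?r"
      using order_trans by blast
  qed
  show "\<forall>i\<in>Inl ` F. \<forall>j\<in>Inl ` F. \<exists>k\<in>Inl ` F. (i, k) \<in> ?r \<and> (j, k) \<in> ?r"
  proof safe
    fix f g assume "f \<in> F" "g \<in> F"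
    moreover from this obtain k where "k \<in> F" "\<forall>x\<in>S. f x \<le> k x \<and> g x \<le> k x"
      using assms(2) by blast
    ultimately show "\<exists>k\<in>Inl ` F. (Inl f, k) \<in> ?r \<and> (Inl g, k) \<in> ?r"
      by blast
  qed
qed (use assms(1) in auto)

text \<open>By contradiction, \<open>pres\<close> being applied to a single net of functions
  vanishing on \<open>A\<close>. These index themselves, so the argument works for every type
  \<open>'i\<close>.\<close>

lemma closure_of_interior_of_if_increases_to_restrict:
  fixes X :: "'a topology"
  assumes cr: "completely_regular_space X" and clo: "closedin X A"
    and pres: "\<And>(I :: ('a, 'i) net_index set) r \<phi> f.
      increases_to (pointwise_order (topspace X) (cfuns b X)) I r \<phi> f \<Longrightarrow>
      increases_to (pointwise_order A (cfuns b (subtopology X A))) I r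
        (\<lambda>i. restrict (\<phi> i) A) (restrict f A)"
  shows "A = X closure_of (X interior_of A)"
proof (rule ccontr)
  assume neq: "A \<noteq> X closure_of (X interior_of A)"
  have sub: "A \<subseteq> topspace X"
    using clo by (rule closedin_subset)
  have "X closure_of (X interior_of A) \<subseteq> A"
    by (simp add: clo closure_of_minimal interior_of_subset)
  then obtain a where a: "a \<in> A" "a \<notin> X closure_of (X interior_of A)"
    using neq by blast
  define W where "W = topspace X - X closure_of (X interior_of A)"
  have W: "openin X W" "a \<in> W"
    using a sub by (auto simp: W_def)
  \<comment> \<open>A nonempty open \<open>T \<subseteq> A\<close> would lie in the interior of
    \<open>A\<close>, whose closure \<open>W\<close> avoids.\<close>
  have dense: "\<exists>y. y \<in> T \<and> y \<notin> A" if "openin X T" "y \<in> T" "T \<subseteq> W" for T y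
  proof (rule ccontr)
    assume "\<not> (\<exists>y. y \<in> T \<and> y \<notin> A)"
    then have "T \<subseteq> X interior_of A"
      using that(1) by (intro interior_of_maximal) auto
    also have "\<dots> \<subseteq> X closure_of (X interior_of A)"
      by (simp add: closure_of_subset interior_of_subset_topspace)
    finally show False
      using that by (auto simp: W_def)
  qed
  obtain h :: "'a \<Rightarrow> real" where h: "continuous_map X euclideanreal h"
    "\<And>y. y \<in> topspace X \<Longrightarrow> 0 \<le> h y \<and> h y \<le> 1" "h a = 1"
    "\<And>y. y \<in> topspace X \<Longrightarrow> y \<notin> W \<Longrightarrow> h y = 0"
    using completely_regular_bump[OF cr W] by metis
  define F where "F = {f \<in> extensional (topspace X). continuous_map X euclideanreal f \<and>
    (\<forall>x\<in>topspace X. 0 \<le> f x \<and> f x \<le> h x) \<and> (\<forall>x\<in>A. f x = 0)}"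
  have F: "restrict f (topspace X) \<in> F" if "continuous_map X euclideanreal f"
    "\<And>x. x \<in> topspace X \<Longrightarrow> 0 \<le> f x \<and> f x \<le> h x" "\<And>x. x \<in> A \<Longrightarrow> f x = 0" for f
    using that sub by (auto simp: F_def continuous_map_restrict_topspace)
  define I :: "('a, 'i) net_index set" where "I = Inl ` F"
  define r :: "(('a, 'i) net_index \<times> ('a, 'i) net_index) set" where
    "r = {(Inl f, Inl g) | f g. f \<in> F \<and> g \<in> F \<and> (\<forall>x\<in>topspace X. f x \<le> g x)}"
  have zero: "(\<lambda>x\<in>topspace X. 0) \<in> F"
    by (rule F) (use h(2) in auto)
  have "directed_set I r"
    unfolding I_def r_def
  proof (rule directed_net_of_functions)
    \<comment> \<open>\<open>F\<close> is closed under pointwise maxima, hence directed.\<close>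
    fix f g assume fg: "f \<in> F" "g \<in> F"
    then have "(\<lambda>x\<in>topspace X. max (f x) (g x)) \<in> F"
      by (intro F continuous_map_real_max) (auto simp: F_def)
    then show "\<exists>k\<in>F. \<forall>x\<in>topspace X. f x \<le> k x \<and> g x \<le> k x"
      by (rule rev_bexI) auto
  qed (use zero in auto)
  \<comment> \<open>Functions between \<open>0\<close> and \<open>h \<le> 1\<close> are bounded, so
    the same net serves both values of \<open>b\<close>.\<close>
  moreover have in_cfuns: "restrict f (topspace X) \<in> cfuns b X"
    if "continuous_map X euclideanreal f" "\<And>x. x \<in> topspace X \<Longrightarrow> 0 \<le> f x \<and> f x \<le> h x" for f
  proof (rule restrict_in_cfuns[OF that(1)])
    have "\<bar>f x\<bar> \<le> 1" if "x \<in> topspace X" for x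
      using h(2)[OF that] \<open>\<And>x. x \<in> topspace X \<Longrightarrow> 0 \<le> f x \<and> f x \<le> h x\<close>[OF that] by linarith
    then show "bounded (f ` topspace X)"
      unfolding bounded_image_real_iff by blast
  qed
  moreover have "f \<in> cfuns b X" if "f \<in> F" for f
    using that in_cfuns[of f] by (auto simp: F_def extensional_restrict)
  moreover have "restrict h (topspace X) \<in> cfuns b X"
    by (rule in_cfuns) (use h in auto)
  moreover have "h x \<le> u x"
    if u: "u \<in> cfuns b X" and uub: "\<And>f y. f \<in> F \<Longrightarrow> y \<in> topspace X \<Longrightarrow> f y \<le> u y"
      and x: "x \<in> topspace X" for u x
  proof (rule ccontr)
    assume neg: "\<not> h x \<le> u x"
    have "0 \<le> u x"
      using uub[OF zero x] x by simp
    \<comment> \<open>Off \<open>W\<close>, \<open>h\<close> is \<open>0\<close>, which is at most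
      \<open>u\<close> because the zero function belongs to \<open>F\<close>.\<close>
    then have "x \<in> W"
      using h(4) neg x by fastforce
    define T where "T = W \<inter> {y \<in> topspace X. h y - u y \<in> {0<..}}"
    have "continuous_map X euclideanreal (\<lambda>y. h y - u y)"
      using u h(1) by (auto simp: cfuns_def intro!: continuous_intros)
    then have "openin X {y \<in> topspace X. h y - u y \<in> {0<..}}"
      by (rule openin_continuous_map_preimage) simp
    then have "openin X T"
      unfolding T_def using W(1) by blast
    moreover have "x \<in> T"
      using \<open>x \<in> W\<close> neg x by (simp add: T_def)
    \<comment> \<open>Density moves the strict inequality \<open>u < h\<close> from \<open>x\<close>
      to a point \<open>y\<close> off \<open>A\<close>, where members of \<open>F\<close> need not
      vanish.\<close>
    ultimately obtain y where y: "y \<in> T" "y \<notin> A"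
      using dense[of T x] by (auto simp: T_def)
    then have yX: "y \<in> topspace X" and less: "u y < h y"
      by (auto simp: T_def)
    have "openin X (topspace X - A)"
      using clo by blast
    then obtain v :: "'a \<Rightarrow> real" where v: "continuous_map X euclideanreal v"
      "\<And>z. z \<in> topspace X \<Longrightarrow> 0 \<le> v z \<and> v z \<le> 1" "v y = 1"
      "\<And>z. z \<in> topspace X \<Longrightarrow> z \<notin> topspace X - A \<Longrightarrow> v z = 0"
      using completely_regular_bump[OF cr, of "topspace X - A" y] yX y(2) by auto
    \<comment> \<open>Multiplying \<open>h\<close> by \<open>v\<close> keeps it between
      \<open>0\<close> and \<open>h\<close>, kills it on \<open>A\<close> and preserves its value at
      \<open>y\<close>, so \<open>u\<close> fails to bound \<open>F\<close> at
      \<open>y\<close>.\<close>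
    have "(\<lambda>z\<in>topspace X. h z * v z) \<in> F"
      by (rule F) (use h v sub in \<open>auto intro!: continuous_intros simp: mult_left_le\<close>)
    then have "h y * v y \<le> u y"
      using uub yX by fastforce
    then show False
      using v(3) less by simp
  qed
  ultimately have "increases_to (pointwise_order (topspace X) (cfuns b X)) I r projl
      (restrict h (topspace X))"
    unfolding increases_to_pointwise_order
    by (intro conjI ballI impI) (simp_all add: I_def r_def, auto simp: F_def)
  then have "increases_to (pointwise_order A (cfuns b (subtopology X A))) I r
      (\<lambda>i. restrict (projl i) A) (restrict (restrict h (topspace X)) A)"
    by (rule pres)
  \<comment> \<open>On \<open>A\<close> the whole net is zero, so zero is an upper bound there,
    contradicting \<open>h a = 1\<close>.\<close>
  moreover have "(\<lambda>x\<in>A. 0) \<in> cfuns b (subtopology X A)"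
    using restrict_in_cfuns[of "subtopology X A" "\<lambda>_. 0" b] sub
    by (simp add: inf_absorb2 bounded_image_real_iff) blast
  moreover have "\<forall>i\<in>I. \<forall>x\<in>A. restrict (projl i) A x \<le> (\<lambda>x\<in>A. 0) x"
    by (simp add: I_def F_def)
  ultimately have "restrict (restrict h (topspace X)) A a \<le> (\<lambda>x\<in>A. 0) a"
    unfolding increases_to_pointwise_order using a(1) by blast
  then show False
    using a(1) sub h(3) by auto
qed

section \<open>The equivalence for both function spaces\<close>

lemma regular_closed_iff_increases_to_restrict:
  fixes X :: "'a topology"
  assumes "completely_regular_space X" and "closedin X A"
  shows "A = X closure_of (X interior_of A) \<longleftrightarrow>
    (\<forall>(I :: ('a, 'i) net_index set) r \<phi>. \<forall>f\<in>cfuns b X.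
       increases_to (pointwise_order (topspace X) (cfuns b X)) I r \<phi> f \<longrightarrow>
       increases_to (pointwise_order A (cfuns b (subtopology X A))) I r
         (\<lambda>i. restrict (\<phi> i) A) (restrict f A))" (is "?L \<longleftrightarrow> ?R")
proof
  assume ?L
  then show ?R
    using increases_to_restrict[OF assms(1)] by blast
next
  assume ?R
  \<comment> \<open>A supremum lies in the space itself, so \<open>?R\<close> applies to every limit
    occurring in the preceding lemma.\<close>
  moreover have "f \<in> cfuns b X"
    if "increases_to (pointwise_order (topspace X) (cfuns b X)) I r \<phi> f"
    for I :: "('a, 'i) net_index set" and r \<phi> f
    using that unfolding increases_to_pointwise_order by blast
  ultimately show ?L
    by (intro closure_of_interior_of_if_increases_to_restrict[OF assms, where b = b and ?'i = 'i])
      blast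
qed

theorem theorem3p3:
  fixes X :: "'a topology" and A :: "'a set"
  assumes "completely_regular_space X" and "Hausdorff_space X" and "closedin X A"
  shows
    "(A = X closure_of (X interior_of A) \<longleftrightarrow>
       (\<forall>(I :: ('a, 'i) net_index set) r \<phi>. \<forall>f\<in>carrier (C_space X).
          increases_to (C_space X) I r \<phi> f \<longrightarrow>
          increases_to (C_space (subtopology X A)) I r (\<lambda>i. restrict (\<phi> i) A) (restrict f A)))
     \<and>
     (A = X closure_of (X interior_of A) \<longleftrightarrow>
       (\<forall>(I :: ('a, 'i) net_index set) r \<phi>. \<forall>f\<in>carrier (Cb_space X).
          increases_to (Cb_space X) I r \<phi> f \<longrightarrow>
          increases_to (Cb_space (subtopology X A)) I r (\<lambda>i. restrict (\<phi> i) A) (restrict f A)))"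
proof -
  have "topspace (subtopology X A) = A"
    using closedin_subset[OF assms(3)] by auto
  then show ?thesis
    unfolding C_space_eq Cb_space_eq carrier_pointwise_order
    by (simp only:) (intro conjI regular_closed_iff_increases_to_restrict assms)
qed

end
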